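(* Let $\varepsilon>0$ and choose $k\in\mathbb{N}$ sufficiently large that $$k\ \ge\ \frac{\log\!\left(\frac{(1-\beta)\varepsilon}{2c_{\max}}\right)}{\log\beta}.$$ Let $\hat V_k:\mathcal{M}\times\{0,1,\ldots,k\}\to\mathbb{R}$ be the solution of the Bellman equation $$\hat V_k(s,z)=\min_{u\in\{1,2,3\}}\hat V^u_k(s,z),\qquad s\in\mathcal{M},\ z\in\{0,1,\ldots,k\},$$ where $$\hat V^1_k(s,z)=\hat c(s,z,1)+\beta\big(\hat V_k(s,1+z)\,\mathbb{1}(z<k)+\hat V_k(0,0)\,\mathbb{1}(z=k)\big),$$ $$\hat V^2_k(s,z)=\hat c(s,z,2)+\beta\sum_{m\in\mathcal{M}}T_{\mathsf m}^{1+z}(m,s)\,\hat V_k(m,0),$$ $$\hat V^3_k(s,z)=\hat c(s,z,3)+\beta\,\hat V_k(0,0).$$ Let $g^*_\varepsilon$ be the strategy $u_t=g^*_\varepsilon(s_t,z_t)$, where, for $s\in\mathcal{M}$ and $z\in\{0,\ldots,k\}$, $g^*_\varepsilon(s,z)=u$ for some $u\in\{1,2,3\}$ with $\hat V^u_k(s,z)=\hat V_k(s,z)$ (ties broken arbitrarily, and actions at $z>k$ arbitrary). Then $g^*_\varepsilon$ is an $\varepsilon$-optimal strategy, i.e. $$|J^*-J(g^*_\varepsilon)|\le\varepsilon .$$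
   Context: Notation: $\mathbb{N}=\{1,2,\ldots\}$, $\mathbb{1}(\cdot)$ is the indicator function, $x_{a:b}=(x_a,\ldots,x_b)$. $\mathrm{binopdf}(y,N,q)=\binom{N}{y}q^y(1-q)^{N-y}$ is the binomial probability of $y$ successes in $N$ trials with success probability $q$ (with $0^0=1$; it is $0$ for $y\notin\{0,\ldots,N\}$). Model: Let $n\in\mathbb{N}$, $p\in[0,1]$, $\beta\in(0,1)$. There are $n$ components; $x^i_t\in\{0,1\}$ is the state of component $i$ at time $t\in\mathbb{N}$ ($0$ = operating, $1$ = faulty). The action at time $t$ is $u_t\in\mathcal{U}=\{1,2,3\}$ (1 = do nothing, 2 = inspect, 3 = repair). Given the whole past (states and actions up to time $t$), the next states $x^1_{t+1},\ldots,x^n_{t+1}$ are independent, with $\mathbb{P}(x^i_{t+1}=1\mid x^i_t=0,u_t\in\{1,2\})=p$, $\mathbb{P}(x^i_{t+1}=1\mid x^i_t=1,u_t\in\{1,2\})=1$, $\mathbb{P}(x^i_{t+1}=1\mid x^i_t,u_t=3)=0$. The number of faulty components is $m_t=\sum_{i=1}^n x^i_t\in\mathcal{M}=\{0,\ldots,n\}$, with $m_1=0$. The observation $o_t\in\mathcal{M}\cup\{\mathtt{blank}\}$ satisfies $o_1=0$, and: if $u_t=1$ then $o_{t+1}=\mathtt{blank}$; if $u_t=2$ then $o_{t+1}=m_{t+1}$; if $u_t=3$ then $o_{t+1}=0$. A strategy $g$ maps the information available at time $t$ to an action: $u_t=g(o_{1:t},u_{1:t-1})$. Cost: $c:\mathcal{M}\times\mathcal{U}\to\mathbb{R}$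 is the per-step cost, $c_{\max}>0$ is a bound on it, $|c(m,u)|\le c_{\max}$ for all $m,u$. The cost of a strategy is $J(g)=\mathbb{E}\big[\sum_{t=1}^\infty\beta^{t-1}c(m_t,u_t)\big]$, and $J^*=\inf_g J(g)$ is the cost under the optimal strategy (over all strategies $g$). Information state: $s_t\in\mathcal{M}$ is the last non-blank observation up to and including time $t$, and $z_t\in\mathbb{N}\cup\{0\}$ is the time elapsed between that observation and $t$; so $(s_1,z_1)=(0,0)$, and $(s_{t+1},z_{t+1})=(s_t,1+z_t)$ if $u_t=1$, $(o_{t+1},0)$ if $u_t=2$, $(0,0)$ if $u_t=3$. Transition matrix under actions $\{1,2\}$: $T_{\mathsf m}(m',m)=\mathbb{P}(m_{t+1}=m'\mid m_t=m,u_t\in\{1,2\})$ for $m',m\in\mathcal{M}$, i.e. $T_{\mathsf m}(m',0)=\mathrm{binopdf}(m',n,p)$, $T_{\mathsf m}(m',n)=\mathbb{1}(m'=n)$, and for $0<m<n$, $T_{\mathsf m}(m',m)=\sum_{j=0}^{m'}\mathrm{binopdf}(j,m,1)\,\mathrm{binopdf}(m'-j,n-m,p)$. $T_{\mathsf m}^{j}$ is the $j$-th matrix power ($T_{\mathsf m}^0$ the identity). Define $\hat c(s,z,u)=\sum_{m\in\mathcal{M}}c(m,u)\,T_{\mathsf m}^{z}(m,s)$. *)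

theory Defs
  imports "HOL-Probability.Probability" "Jordan_Normal_Form.Matrix"
begin

section \<open>The controlled system\<close>

(* The actions 1, 2, 3. *)
datatype action = Wait | Inspect | Repair

(* "state i" holds iff component i is faulty; components are 0, ..., n - 1. *)
type_synonym state = "nat \<Rightarrow> bool"

(* None is the blank observation. *)
type_synonym observation = "nat option"

(* A strategy receives the observations o_1, ..., o_t and the actions u_1, ..., u_(t-1),
   oldest first. *)
type_synonym strategy = "observation list \<Rightarrow> action list \<Rightarrow> action"

definition faults :: "nat \<Rightarrow> state \<Rightarrow> nat" where
  "faults n x = card {i. i < n \<and> x i}"

definition component_step :: "real \<Rightarrow> action \<Rightarrow> bool \<Rightarrow> bool pmf" where
  "component_step p u faulty =
     (case u of
        Repair \<Rightarrow> return_pmf False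
      | _ \<Rightarrow> if faulty then return_pmf True else bernoulli_pmf p)"

definition system_step :: "nat \<Rightarrow> real \<Rightarrow> action \<Rightarrow> state \<Rightarrow> state pmf" where
  "system_step n p u x = Pi_pmf {..<n} False (\<lambda>i. component_step p u (x i))"

fun observe :: "action \<Rightarrow> nat \<Rightarrow> observation" where
  "observe Wait m' = None"
| "observe Inspect m' = Some m'"
| "observe Repair m' = Some 0"

(* Time starts at 0 here: index t stands for time t + 1 in the convention where time runs
   through 1, 2, ...  "history n g x t" consists of the observations up to and including
   index t and of the actions strictly before it, along the state trajectory x. *)
primrec history ::
    "nat \<Rightarrow> strategy \<Rightarrow> (nat \<Rightarrow> state) \<Rightarrow> nat \<Rightarrow> observation list \<times> action list" where
  "history n g x 0 = ([Some 0], [])"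
| "history n g x (Suc t) =
     (case history n g x t of (os, us) \<Rightarrow>
        let u = g os us in (os @ [observe u (faults n (x (Suc t)))], us @ [u]))"

definition action_at :: "nat \<Rightarrow> strategy \<Rightarrow> (nat \<Rightarrow> state) \<Rightarrow> nat \<Rightarrow> action" where
  "action_at n g x t = (case history n g x t of (os, us) \<Rightarrow> g os us)"

(* Law of the state at index t given the states at all earlier indices. The past actions are
   functions of the past states, so this conditions on the whole past. *)
fun transition :: "nat \<Rightarrow> real \<Rightarrow> strategy \<Rightarrow> nat \<Rightarrow> (nat \<Rightarrow> state) \<Rightarrow> state measure" where
  "transition n p g 0 x = measure_pmf (return_pmf (\<lambda>_. False))"
| "transition n p g (Suc t) x = measure_pmf (system_step n p (action_at n g x t) (x t))"

(* Law of the infinite state trajectory under g, by the Ionescu-Tulcea theorem. *)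
definition trajectory_measure :: "nat \<Rightarrow> real \<Rightarrow> strategy \<Rightarrow> (nat \<Rightarrow> state) measure" where
  "trajectory_measure n p g =
     projective_family.lim UNIV
       (Ionescu_Tulcea.CI (transition n p g) (\<lambda>_. count_space UNIV)) (\<lambda>_. count_space UNIV)"

definition cost ::
    "nat \<Rightarrow> real \<Rightarrow> real \<Rightarrow> (nat \<Rightarrow> action \<Rightarrow> real) \<Rightarrow> strategy \<Rightarrow> real" where
  "cost n p \<beta> c g =
     (\<integral>x. (\<Sum>t. \<beta> ^ t * c (faults n (x t)) (action_at n g x t)) \<partial>trajectory_measure n p g)"

definition optimal_cost :: "nat \<Rightarrow> real \<Rightarrow> real \<Rightarrow> (nat \<Rightarrow> action \<Rightarrow> real) \<Rightarrow> real" where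
  "optimal_cost n p \<beta> c = (INF g. cost n p \<beta> c g)"


section \<open>Information state\<close>

fun info_step :: "action \<times> observation \<Rightarrow> nat \<times> nat \<Rightarrow> nat \<times> nat" where
  "info_step (Wait, ob) (s, z) = (s, 1 + z)"
| "info_step (Inspect, ob) (s, z) = (the ob, 0)"
| "info_step (Repair, ob) (s, z) = (0, 0)"

(* The first observation precedes every action and is always 0; the observation caused by the
   j-th action is the (j+1)-st one, hence "tl". *)
definition info_state :: "observation list \<Rightarrow> action list \<Rightarrow> nat \<times> nat" where
  "info_state os us = fold info_step (zip us (tl os)) (0, 0)"

definition info_strategy :: "(nat \<Rightarrow> nat \<Rightarrow> action) \<Rightarrow> strategy" where
  "info_strategy \<gamma> = (\<lambda>os us. case info_state os us of (s, z) \<Rightarrow> \<gamma> s z)"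


section \<open>Transition matrix and Bellman equation\<close>

definition binopdf :: "nat \<Rightarrow> nat \<Rightarrow> real \<Rightarrow> real" where
  "binopdf y N q = real (N choose y) * q ^ y * (1 - q) ^ (N - y)"

(* The entry at row m' and column m is the probability of moving from m to m' faults. *)
definition Tm :: "nat \<Rightarrow> real \<Rightarrow> real mat" where
  "Tm n p = mat (n + 1) (n + 1) (\<lambda>(m', m).
     if m = 0 then binopdf m' n p
     else if m = n then of_bool (m' = n)
     else (\<Sum>j\<le>m'. binopdf j m 1 * binopdf (m' - j) (n - m) p))"

definition c_hat ::
    "nat \<Rightarrow> real \<Rightarrow> (nat \<Rightarrow> action \<Rightarrow> real) \<Rightarrow> nat \<Rightarrow> nat \<Rightarrow> action \<Rightarrow> real" where
  "c_hat n p c s z u = (\<Sum>m\<le>n. c m u * (Tm n p ^\<^sub>m z) $$ (m, s))"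

fun action_value ::
    "nat \<Rightarrow> real \<Rightarrow> real \<Rightarrow> (nat \<Rightarrow> action \<Rightarrow> real) \<Rightarrow> nat \<Rightarrow> (nat \<Rightarrow> nat \<Rightarrow> real)
      \<Rightarrow> action \<Rightarrow> nat \<Rightarrow> nat \<Rightarrow> real" where
  "action_value n p \<beta> c k V Wait s z =
     c_hat n p c s z Wait + \<beta> * (V s (1 + z) * of_bool (z < k) + V 0 0 * of_bool (z = k))"
| "action_value n p \<beta> c k V Inspect s z =
     c_hat n p c s z Inspect + \<beta> * (\<Sum>m\<le>n. (Tm n p ^\<^sub>m (1 + z)) $$ (m, s) * V m 0)"
| "action_value n p \<beta> c k V Repair s z =
     c_hat n p c s z Repair + \<beta> * V 0 0"

definition solves_bellman ::
    "nat \<Rightarrow> real \<Rightarrow> real \<Rightarrow> (nat \<Rightarrow> action \<Rightarrow> real) \<Rightarrow> nat \<Rightarrow> (nat \<Rightarrow> nat \<Rightarrow> real) \<Rightarrow> bool" where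
  "solves_bellman n p \<beta> c k V \<longleftrightarrow>
     (\<forall>s\<le>n. \<forall>z\<le>k. V s z = (MIN u\<in>{Wait, Inspect, Repair}. action_value n p \<beta> c k V u s z))"


section \<open>The trajectory measure is well defined\<close>

instance action :: countable
  by countable_datatype

lemma history_measurable:
  assumes "{..t} \<subseteq> J"
  shows "(\<lambda>x. history n g x t) \<in>
    measurable (PiM J (\<lambda>_. count_space UNIV)) (count_space UNIV)"
  using assms
proof (induction t)
  case 0
  show ?case by simp
next
  case (Suc t)
  let ?M = "PiM J (\<lambda>_. count_space UNIV) :: (nat \<Rightarrow> state) measure"
  let ?F = "\<lambda>((os, us), m). let u = g os us in (os @ [observe u m], us @ [u])"
  have [measurable]: "(\<lambda>x. history n g x t) \<in> measurable ?M (count_space UNIV)"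
    by (rule Suc.IH) (use Suc.prems in force)
  have comp: "(\<lambda>x. x (Suc t)) \<in> measurable ?M (count_space UNIV)"
    using Suc.prems by (intro measurable_component_singleton) auto
  have [measurable]: "(\<lambda>x. faults n (x (Suc t))) \<in> measurable ?M (count_space UNIV)"
    by (rule measurable_compose[OF comp]) simp
  have "(\<lambda>x. (history n g x t, faults n (x (Suc t)))) \<in> measurable ?M (count_space UNIV)"
    by measurable
  moreover have "?F \<in> measurable (count_space UNIV) (count_space UNIV)"
    by simp
  ultimately have "(\<lambda>x. ?F (history n g x t, faults n (x (Suc t)))) \<in>
      measurable ?M (count_space UNIV)"
    by (rule measurable_compose)
  then show ?case by simp
qed

lemma action_at_measurable:
  assumes "{..t} \<subseteq> J"
  shows "(\<lambda>x. action_at n g x t) \<in>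
    measurable (PiM J (\<lambda>_. count_space UNIV)) (count_space UNIV)"
  unfolding action_at_def
  by (rule measurable_compose[OF history_measurable[OF assms]]) simp

lemma system_step_restrict:
  "system_step n p u x = system_step n p u (\<lambda>i. i \<in> {i. i < n \<and> x i})"
  unfolding system_step_def by (rule Pi_pmf_cong) auto

lemma transition_measurable:
  "transition n p g t \<in> measurable (PiM {0..<t} (\<lambda>_. count_space UNIV))
     (subprob_algebra (count_space UNIV))"
proof (cases t)
  case 0
  have "(\<lambda>_. measure_pmf (return_pmf (\<lambda>_. False)) :: state measure) \<in>
      measurable (PiM {0..<t} (\<lambda>_. count_space UNIV :: state measure))
        (subprob_algebra (count_space UNIV))"
    by (intro measurable_const)
      (simp add: space_subprob_algebra prob_space_imp_subprob_space prob_space_measure_pmf)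
  moreover have "transition n p g t = (\<lambda>_. measure_pmf (return_pmf (\<lambda>_. False)))"
    using 0 by auto
  ultimately show ?thesis by simp
next
  case (Suc t')
  let ?M = "PiM {0..<t} (\<lambda>_. count_space UNIV) :: (nat \<Rightarrow> state) measure"
  let ?code = "\<lambda>x. (action_at n g x t', map (x t') [0..<n])"
  let ?F = "\<lambda>(u, bs). measure_pmf (system_step n p u (\<lambda>i. i < n \<and> bs ! i))"
  have [measurable]: "(\<lambda>x. action_at n g x t') \<in> measurable ?M (count_space UNIV)"
    using Suc by (intro action_at_measurable) auto
  have comp: "(\<lambda>x. x t') \<in> measurable ?M (count_space UNIV)"
    using Suc by (intro measurable_component_singleton) auto
  have [measurable]: "(\<lambda>x. map (x t') [0..<n]) \<in> measurable ?M (count_space UNIV)"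
    by (rule measurable_compose[OF comp]) simp
  have "?code \<in> measurable ?M (count_space UNIV)"
    by measurable
  moreover have "?F \<in> measurable (count_space UNIV) (subprob_algebra (count_space UNIV))"
    by (auto simp: space_subprob_algebra intro!: prob_space_imp_subprob_space
        prob_space_measure_pmf)
  ultimately have meas: "(\<lambda>x. ?F (?code x)) \<in> measurable ?M (subprob_algebra (count_space UNIV))"
    by (rule measurable_compose)
  have "?F (?code x) = transition n p g t x" for x
    unfolding Suc by (simp, subst (2) system_step_restrict)
      (auto intro!: arg_cong[where f = measure_pmf] arg_cong[where f = "system_step n p _"])
  then have "(\<lambda>x. ?F (?code x)) = transition n p g t"
    by (rule ext)
  with meas show ?thesis by (simp only:)
qed

lemma Ionescu_Tulcea_transition:
  "Ionescu_Tulcea (transition n p g) (\<lambda>_. count_space UNIV)"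
proof (rule Ionescu_Tulcea.intro)
  show "transition n p g t \<in> measurable (PiM {0..<t} (\<lambda>_. count_space UNIV))
      (subprob_algebra (count_space UNIV))" for t
    by (rule transition_measurable)
  show "prob_space (transition n p g t x)" for t x
    by (cases t) (simp_all add: prob_space_measure_pmf)
qed

lemma prob_space_trajectory_measure: "prob_space (trajectory_measure n p g)"
proof -
  interpret IT: Ionescu_Tulcea "transition n p g" "\<lambda>_. count_space UNIV"
    by (rule Ionescu_Tulcea_transition)
  have lim: "trajectory_measure n p g = IT.PF.lim"
    by (simp add: trajectory_measure_def)
  have "prob_space (IT.CI {})"
    by (rule IT.PF.prob_space_P) auto
  then have "prob_space (distr IT.PF.lim (PiM {} (\<lambda>_. count_space UNIV)) (\<lambda>x. restrict x {}))"
    by (simp only: IT.distr_lim[OF finite.emptyI])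
  then show ?thesis
    unfolding lim by (rule prob_space_distrD[rotated])
      (auto intro!: measurable_restrict simp: measurable_cong_sets[OF IT.PF.sets_lim refl])
qed

end

theory Submission
  imports Defs
begin

text \<open>
  Conditioned on the history, the number of faulty components is distributed like the chain with matrix
  \<open>Tm\<close> run for \<open>z\<close> steps from \<open>s\<close>, where \<open>(s, z)\<close> is the information state
  (\<open>joint_law_eq_posterior\<close>, built on \<open>distr_trajectory_measure\<close> and \<open>Tm_power_eq_pmf_belief\<close>). So the
  problem is a discounted decision problem on the information states, with stage cost \<open>c_hat\<close>
  (\<open>cost_sums_stage_cost\<close>).

  The Bellman equation describes a modified model, in which waiting at elapsed time \<open>k\<close> leads to \<open>(0, 0)\<close>
  instead of \<open>(s, k + 1)\<close>. The two models agree up to the first time this happens, and as the elapsed time grows by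
  at most one per step, what comes afterwards is discounted by a factor of at most \<open>\<beta> ^ (k + 1)\<close>. After that
  time the modified model continues with the value \<open>V 0 0\<close>, and the true one with something between \<open>- M\<close> and
  \<open>M\<close>, where \<open>M = c_max / (1 - \<beta>)\<close>. Since \<open>V\<close> is optimal in the modified model, and is attained by
  \<open>\<gamma>\<close>, this gives
    \<open>J g \<ge> V 0 0 - \<beta> ^ (k + 1) * (V 0 0 + M)\<close> for every strategy \<open>g\<close>, and
    \<open>J \<gamma> \<le> V 0 0 + \<beta> ^ (k + 1) * (M - V 0 0)\<close>
  (\<open>cost_ge_truncated_value\<close>, \<open>cost_le_truncated_value\<close>). It is essential to keep the bounds in this
  one-sided form: bounding each deviation from \<open>V 0 0\<close> by \<open>2 * M * \<beta> ^ (k + 1)\<close> would give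
  twice the error. In the difference of the two bounds \<open>V 0 0\<close> cancels, and \<open>2 * M * \<beta> ^ (k + 1) \<le> \<epsilon>\<close>
  remains by the choice of \<open>k\<close>.
\<close>

section \<open>Expectations over finitely supported laws\<close>

lemma expectation_bind_pmf_finite:
  fixes h :: "'b \<Rightarrow> real"
  assumes "finite (set_pmf q)" and "\<And>x. x \<in> set_pmf q \<Longrightarrow> finite (set_pmf (f x))"
  shows "measure_pmf.expectation (q \<bind> f) h =
    measure_pmf.expectation q (\<lambda>x. measure_pmf.expectation (f x) h)"
  using assms
  by (subst pmf_expectation_bind[where A = "set_pmf q"])
    (auto simp: integral_measure_pmf[where A = "set_pmf q"])

lemma abs_expectation_pmf_le:
  fixes f :: "'a \<Rightarrow> real"
  assumes "finite (set_pmf q)" and "\<And>x. x \<in> set_pmf q \<Longrightarrow> \<bar>f x\<bar> \<le> B"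
  shows "\<bar>measure_pmf.expectation q f\<bar> \<le> B"
proof -
  have "\<bar>measure_pmf.expectation q f\<bar> \<le> measure_pmf.expectation q (\<lambda>x. \<bar>f x\<bar>)"
    by (rule integral_abs_bound)
  also have "\<dots> \<le> B"
    using assms by (intro measure_pmf.integral_le_const integrable_measure_pmf_finite)
      (auto simp: AE_measure_pmf_iff)
  finally show ?thesis .
qed

lemma expectation_pmf_mono:
  fixes f g :: "'a \<Rightarrow> real"
  assumes "finite (set_pmf q)" and "\<And>x. x \<in> set_pmf q \<Longrightarrow> f x \<le> g x"
  shows "measure_pmf.expectation q f \<le> measure_pmf.expectation q g"
  using assms by (intro integral_mono_AE integrable_measure_pmf_finite) (auto simp: AE_measure_pmf_iff)

section \<open>The number of faulty components as a Markov chain\<close>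

locale fault_dynamics =
  fixes n :: nat and p :: real
  assumes n_pos: "n \<ge> 1" and p_nonneg: "0 \<le> p" and p_le_1: "p \<le> 1"
begin

definition fault_step :: "nat \<Rightarrow> nat pmf" where
  "fault_step m = map_pmf (\<lambda>j. m + j) (binomial_pmf (n - m) p)"

definition fault_kernel :: "action \<Rightarrow> nat \<Rightarrow> nat pmf" where
  "fault_kernel u m = (if u = Repair then return_pmf 0 else fault_step m)"

lemma fault_kernel_repair [simp]: "fault_kernel Repair = (\<lambda>_. return_pmf 0)"
  and fault_kernel_no_repair: "u \<noteq> Repair \<Longrightarrow> fault_kernel u = fault_step"
  by (auto simp: fault_kernel_def fun_eq_iff)

lemma faults_le: "faults n x \<le> n"
proof -
  have "faults n x \<le> card {..<n}"
    unfolding faults_def by (intro card_mono) auto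
  then show ?thesis by simp
qed

lemma set_pmf_fault_step: "m \<le> n \<Longrightarrow> set_pmf (fault_step m) \<subseteq> {..n}"
  using p_nonneg p_le_1 by (auto simp: fault_step_def set_pmf_binomial_eq split: if_splits)

lemma set_pmf_fault_kernel: "m \<le> n \<Longrightarrow> set_pmf (fault_kernel u m) \<subseteq> {..n}"
  using set_pmf_fault_step[of m] by (auto simp: fault_kernel_def)

text \<open>
  The components that are already faulty stay so, and the others fail independently with probability
  \<open>p\<close>. Hence the number of new faults is binomial, whatever the identity of the faulty components; this
  is why the fault count alone is a Markov chain.
\<close>
lemma map_faults_degradation:
  "map_pmf (faults n) (Pi_pmf {..<n} False (\<lambda>i. if x i then return_pmf True else bernoulli_pmf p))
    = fault_step (faults n x)" (is "map_pmf _ (Pi_pmf _ _ ?P) = _")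
proof -
  \<comment> \<open>\<open>A\<close> are the components that stay faulty for certain, \<open>B\<close> those that may still fail.\<close>
  define A where "A = {i. i < n \<and> x i}"
  define B where "B = {i. i < n \<and> \<not> x i}"
  have fin: "finite A" "finite B" "A \<inter> B = {}" and un: "{..<n} = A \<union> B"
    by (auto simp: A_def B_def)
  have cA: "card A = faults n x" by (simp add: A_def faults_def)
  have "card A + card B = n"
    using card_Un_disjoint[OF fin] un by (metis card_lessThan)
  then have cB: "card B = n - faults n x" using cA by simp
  have PA: "Pi_pmf A False ?P = return_pmf (\<lambda>i. i \<in> A)"
  proof -
    have "Pi_pmf A False ?P = Pi_pmf A False (\<lambda>_. return_pmf True)"
      by (rule Pi_pmf_cong) (auto simp: A_def)
    then show ?thesis using fin by simp
  qed
  have PB: "Pi_pmf B False ?P = Pi_pmf B False (\<lambda>_. bernoulli_pmf p)"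
    by (rule Pi_pmf_cong) (auto simp: B_def)
  have split: "faults n (\<lambda>i. if i \<in> A then i \<in> A else y i) = card A + card {i\<in>B. y i}" for y
  proof -
    have "{i. i < n \<and> (if i \<in> A then i \<in> A else y i)} = A \<union> {i\<in>B. y i}"
      by (auto simp: A_def B_def)
    moreover have "card (A \<union> {i\<in>B. y i}) = card A + card {i\<in>B. y i}"
      using fin by (intro card_Un_disjoint) auto
    ultimately show ?thesis unfolding faults_def by simp
  qed
  have "map_pmf (faults n) (Pi_pmf {..<n} False ?P) =
      map_pmf (\<lambda>y. card A + card {i\<in>B. y i}) (Pi_pmf B False (\<lambda>_. bernoulli_pmf p))"
    unfolding un Pi_pmf_union[OF fin] PA PB pair_return_pmf1
    by (simp only: map_pmf_comp prod.case split)
  also have "\<dots> = map_pmf (\<lambda>j. card A + j)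
      (map_pmf (\<lambda>y. card {i\<in>B. y i}) (Pi_pmf B False (\<lambda>_. bernoulli_pmf p)))"
    by (simp add: map_pmf_comp)
  also have "\<dots> = fault_step (faults n x)"
    using binomial_pmf_altdef'[OF fin(2) cB, of p False] p_nonneg p_le_1
    by (simp add: fault_step_def cA)
  finally show ?thesis .
qed

lemma map_faults_system_step:
  "map_pmf (faults n) (system_step n p u x) = fault_kernel u (faults n x)"
proof (cases u)
  case Repair
  have "system_step n p Repair x = return_pmf (\<lambda>_. False)"
    by (simp add: system_step_def component_step_def)
  then show ?thesis using Repair by (simp add: fault_kernel_def faults_def)
qed (simp_all add: system_step_def component_step_def fault_kernel_def map_faults_degradation)

section \<open>Beliefs and powers of the transition matrix\<close>

text \<open>
  What is known about the fault count \<open>z\<close> steps after \<open>s\<close> faults were seen, if nothing was repaired or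
  observed since. A probability mass function is easier to condition and to compose than a column of a matrix power;
  \<open>Tm_power_eq_pmf_belief\<close> identifies the two.
\<close>
primrec belief :: "nat \<Rightarrow> nat \<Rightarrow> nat pmf" where
  "belief s 0 = return_pmf s"
| "belief s (Suc z) = belief s z \<bind> fault_step"

lemma set_pmf_belief: "s \<le> n \<Longrightarrow> set_pmf (belief s z) \<subseteq> {..n}"
proof (induction z)
  case (Suc z)
  then show ?case using set_pmf_fault_step by fastforce
qed simp

lemma finite_set_pmf_belief: "s \<le> n \<Longrightarrow> finite (set_pmf (belief s z))"
  using set_pmf_belief finite_subset by blast

lemma abs_expectation_belief_le:
  fixes f :: "nat \<Rightarrow> real"
  assumes "s \<le> n" and "\<And>m. m \<le> n \<Longrightarrow> \<bar>f m\<bar> \<le> B"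
  shows "\<bar>measure_pmf.expectation (belief s z) f\<bar> \<le> B"
  using set_pmf_belief[OF assms(1), of z] assms
  by (intro abs_expectation_pmf_le finite_set_pmf_belief) auto

text \<open>
  Matrix powers peel off the first step of the chain, while filtering appends a last step, so both
  recursions are needed.
\<close>
lemma belief_Suc_first: "belief s (Suc z) = fault_step s \<bind> (\<lambda>m. belief m z)"
  by (induction z) (simp_all add: bind_return_pmf bind_return_pmf' bind_assoc_pmf)

lemma binopdf_certain: "binopdf j m 1 = of_bool (j = m)"
  by (cases "j < m") (auto simp: binopdf_def)

lemma Tm_eq_pmf_fault_step:
  assumes "m \<le> n" "m' \<le> n"
  shows "Tm n p $$ (m', m) = pmf (fault_step m) m'"
proof -
  have binom: "pmf (binomial_pmf N p) j = binopdf j N p" for N j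
    using p_nonneg p_le_1 by (simp add: binopdf_def)
  have *: "pmf (fault_step m) m' = (if m \<le> m' then binopdf (m' - m) (n - m) p else 0)"
  proof (cases "m \<le> m'")
    case True
    have "pmf (fault_step m) (m + (m' - m)) = pmf (binomial_pmf (n - m) p) (m' - m)"
      unfolding fault_step_def by (rule pmf_map_inj') (simp add: inj_def)
    then show ?thesis using True binom by simp
  next
    case False
    then have "m' \<notin> set_pmf (fault_step m)" by (auto simp: fault_step_def)
    then show ?thesis using False by (simp add: set_pmf_iff)
  qed
  \<comment> \<open>The sum is the convolution of the \<open>m\<close> certain faults with the new ones, and only \<open>j = m\<close> counts.\<close>
  have "(\<Sum>j\<le>m'. binopdf j m 1 * binopdf (m' - j) (n - m) p) =
      (\<Sum>j\<le>m'. if j = m then binopdf (m' - j) (n - m) p else 0)"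
    by (intro sum.cong) (auto simp: binopdf_certain)
  then have "(\<Sum>j\<le>m'. binopdf j m 1 * binopdf (m' - j) (n - m) p) =
      (if m \<le> m' then binopdf (m' - m) (n - m) p else 0)"
    by simp
  moreover have "binopdf (m' - n) 0 p = of_bool (m' \<le> n)"
    by (simp add: binopdf_def)
  ultimately show ?thesis
    using assms n_pos unfolding * by (auto simp: Tm_def)
qed

lemma Tm_power_eq_pmf_belief:
  assumes "s \<le> n" "m \<le> n"
  shows "(Tm n p ^\<^sub>m z) $$ (m, s) = pmf (belief s z) m"
  using assms
proof (induction z arbitrary: s)
  case 0
  then show ?case by (simp add: Tm_def pmf_return)
next
  case (Suc z)
  have dim: "Tm n p \<in> carrier_mat (n + 1) (n + 1)" by (simp add: Tm_def)
  have "(Tm n p ^\<^sub>m Suc z) $$ (m, s) = (\<Sum>j\<in>{0..<n+1}. (Tm n p ^\<^sub>m z) $$ (m, j) * Tm n p $$ (j, s))"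
    using Suc.prems dim by (simp add: scalar_prod_def)
  also have "\<dots> = (\<Sum>j\<le>n. pmf (belief j z) m * pmf (fault_step s) j)"
    using Suc by (intro sum.cong) (auto simp: Tm_eq_pmf_fault_step)
  also have "\<dots> = measure_pmf.expectation (fault_step s) (\<lambda>j. pmf (belief j z) m)"
    using set_pmf_fault_step[OF Suc.prems(1)]
    by (subst integral_measure_pmf_real[where A = "{..n}"]) auto
  also have "\<dots> = pmf (belief s (Suc z)) m"
    unfolding belief_Suc_first by (rule pmf_bind[symmetric])
  finally show ?case .
qed

lemma expectation_belief:
  assumes "s \<le> n"
  shows "measure_pmf.expectation (belief s z) f = (\<Sum>m\<le>n. (Tm n p ^\<^sub>m z) $$ (m, s) * f m)"
  using set_pmf_belief[OF assms, of z] Tm_power_eq_pmf_belief[OF assms]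
  by (subst integral_measure_pmf_real[where A = "{..n}"]) (auto simp: mult.commute intro!: sum.cong)

lemma c_hat_eq_expectation:
  "s \<le> n \<Longrightarrow> c_hat n p c s z u = measure_pmf.expectation (belief s z) (\<lambda>m. c m u)"
  by (simp add: c_hat_def expectation_belief mult.commute)

lemma action_value_Inspect:
  "s \<le> n \<Longrightarrow> action_value n p \<beta> c k V Inspect s z =
    c_hat n p c s z Inspect + \<beta> * measure_pmf.expectation (belief s (Suc z)) (\<lambda>m. V m 0)"
  by (simp only: action_value.simps expectation_belief plus_1_eq_Suc)

end

section \<open>The joint law of the history and the fault count\<close>

definition next_history ::
    "strategy \<Rightarrow> observation list \<times> action list \<Rightarrow> nat \<Rightarrow> observation list \<times> action list" where
  "next_history g h m = (let u = case_prod g h in (fst h @ [observe u m], snd h @ [u]))"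

lemma history_Suc_next:
  "history n g x (Suc t) = next_history g (history n g x t) (faults n (x (Suc t)))"
  by (simp add: next_history_def case_prod_beta Let_def)

lemma history_cong:
  "(\<And>i. i \<le> t \<Longrightarrow> x i = y i) \<Longrightarrow> history n g x t = history n g y t"
  by (induction t) (simp_all add: history_Suc_next del: history.simps(2))

context fault_dynamics
begin

text \<open>
  The states enter the history and the cost only through the fault count, so the pair of history and
  current fault count is a Markov chain. Unlike the trajectory measure, its laws at fixed times are finitely
  supported and defined by recursion.
\<close>
primrec joint_law :: "strategy \<Rightarrow> nat \<Rightarrow> ((observation list \<times> action list) \<times> nat) pmf" where
  "joint_law g 0 = return_pmf (([Some 0], []), 0)"
| "joint_law g (Suc t) = joint_law g t \<bind>
     (\<lambda>(h, m). map_pmf (\<lambda>m'. (next_history g h m', m')) (fault_kernel (case_prod g h) m))"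

lemma history_faults_measurable:
  assumes "{..t} \<subseteq> J"
  shows "(\<lambda>x. (history n g x t, faults n (x t))) \<in>
    measurable (PiM J (\<lambda>_. count_space UNIV)) (count_space UNIV)"
proof -
  have "(\<lambda>x. x t) \<in> measurable (PiM J (\<lambda>_. count_space UNIV)) (count_space UNIV)"
    using assms by (intro measurable_component_singleton) auto
  then have [measurable]: "(\<lambda>x. faults n (x t)) \<in>
      measurable (PiM J (\<lambda>_. count_space UNIV)) (count_space UNIV)"
    by (rule measurable_compose) simp
  note [measurable] = history_measurable[OF assms]
  show ?thesis by measurable
qed

text \<open>
  The bridge from the Ionescu-Tulcea measure to elementary probability: everything about the cost
  can be computed from \<open>joint_law\<close>.
\<close>
lemma distr_trajectory_measure:
  "distr (trajectory_measure n p g) (count_space UNIV) (\<lambda>x. (history n g x t, faults n (x t)))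
    = measure_pmf (joint_law g t)"
proof -
  interpret IT: Ionescu_Tulcea "transition n p g" "\<lambda>_. count_space UNIV"
    by (rule Ionescu_Tulcea_transition)
  define obs where "obs t x = (history n g x t, faults n (x t))" for t x
  let ?P = "\<lambda>t. PiM {0..<t} (\<lambda>_. count_space UNIV) :: (nat \<Rightarrow> state) measure"
  have sets_C: "sets (IT.C 0 (Suc t) (\<lambda>_. undefined)) = sets (?P (Suc t))" for t
    by (subst IT.sets_C) (simp_all add: space_PiM)
  have obs_meas [measurable]: "obs t \<in> measurable (?P (Suc t)) (count_space UNIV)" for t
    unfolding obs_def by (rule history_faults_measurable) auto
  have fin: "distr (IT.C 0 (Suc t) (\<lambda>_. undefined)) (count_space UNIV) (obs t) = measure_pmf (joint_law g t)" for t
  proof (induction t)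
    case 0
    have 1: "IT.C 0 (Suc 0) (\<lambda>_. undefined) = IT.eP 0 (\<lambda>_. undefined)"
      using IT.measurable_eP[of 0] by (simp add: bind_return space_PiM)
    have upd: "fun_upd (\<lambda>_. undefined) 0 \<in> measurable (count_space UNIV) (?P (Suc 0))"
      by (rule measurable_fun_upd[where J = "{}"]) (auto simp: space_PiM)
    have "obs 0 (fun_upd (\<lambda>_. undefined) 0 (\<lambda>_. False)) = (([Some 0], []), 0)"
      by (simp add: obs_def faults_def)
    then show ?case
      unfolding 1 IT.eP_def using upd obs_meas[of 0]
      by (subst distr_distr) (auto simp: comp_def return_pmf.rep_eq distr_return)
  next
    case (Suc t)
    let ?C = "IT.C 0 (Suc t) (\<lambda>_. undefined)"
    let ?K = "\<lambda>(h, m). map_pmf (\<lambda>m'. (next_history g h m', m')) (fault_kernel (case_prod g h) m)"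
    have sp: "space ?C = space (?P (Suc t))"
      by (subst IT.space_C) (simp_all add: space_PiM)
    have ne: "space ?C \<noteq> {}" unfolding sp by (simp add: space_PiM_empty_iff)
    \<comment> \<open>Drawing one more state extends the pair by the kernel of the recursion for \<open>joint_law\<close>.\<close>
    have kernel: "distr (IT.eP (Suc t) \<omega>) (count_space UNIV) (obs (Suc t)) = measure_pmf (?K (obs t \<omega>))"
      if \<omega>: "\<omega> \<in> space (?P (Suc t))" for \<omega>
    proof -
      have upd: "fun_upd \<omega> (Suc t) \<in> measurable (count_space UNIV) (?P (Suc (Suc t)))"
        using \<omega> by (intro measurable_fun_upd[where J = "{0..<Suc t}"]) auto
      have h: "history n g (fun_upd \<omega> (Suc t) y) t = history n g \<omega> t" for y
        by (rule history_cong) auto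
      let ?S = "system_step n p (action_at n g \<omega> t) (\<omega> t)"
      let ?f = "\<lambda>m'. (next_history g (history n g \<omega> t) m', m')"
      have "distr (IT.eP (Suc t) \<omega>) (count_space UNIV) (obs (Suc t)) =
          distr (measure_pmf ?S) (count_space UNIV) (\<lambda>y. obs (Suc t) (fun_upd \<omega> (Suc t) y))"
        unfolding IT.eP_def using upd by (subst distr_distr) (auto simp: comp_def)
      also have "\<dots> = measure_pmf (map_pmf (\<lambda>y. ?f (faults n y)) ?S)"
        unfolding obs_def history_Suc_next h by (simp add: map_pmf_rep_eq)
      also have "map_pmf (\<lambda>y. ?f (faults n y)) ?S = map_pmf ?f (map_pmf (faults n) ?S)"
        by (simp add: map_pmf_comp)
      also have "\<dots> = ?K (obs t \<omega>)"
        unfolding map_faults_system_step by (simp add: obs_def action_at_def)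
      finally show ?thesis .
    qed
    have K: "(\<lambda>x. measure_pmf (?K x)) \<in> measurable (count_space UNIV) (subprob_algebra (count_space UNIV))"
      by (auto simp: space_subprob_algebra intro!: prob_space_imp_subprob_space prob_space_measure_pmf)
    have eP: "IT.eP (Suc t) \<in> measurable ?C (subprob_algebra (?P (Suc (Suc t))))"
      unfolding measurable_cong_sets[OF sets_C refl] by (rule IT.measurable_eP)
    have obs_C: "obs t \<in> measurable ?C (count_space UNIV)"
      unfolding measurable_cong_sets[OF sets_C refl] by (rule obs_meas)
    have "IT.C 0 (Suc (Suc t)) (\<lambda>_. undefined) = ?C \<bind> IT.eP (Suc t)"
      by simp
    then have "distr (IT.C 0 (Suc (Suc t)) (\<lambda>_. undefined)) (count_space UNIV) (obs (Suc t)) =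
        ?C \<bind> (\<lambda>\<omega>. distr (IT.eP (Suc t) \<omega>) (count_space UNIV) (obs (Suc t)))"
      by (simp only: distr_bind[OF eP ne obs_meas])
    also have "\<dots> = ?C \<bind> (\<lambda>\<omega>. measure_pmf (?K (obs t \<omega>)))"
      by (intro bind_cong refl kernel) (simp only: sp)
    also have "\<dots> = distr ?C (count_space UNIV) (obs t) \<bind> (\<lambda>x. measure_pmf (?K x))"
      by (rule bind_distr[OF obs_C K ne, symmetric])
    also have "\<dots> = measure_pmf (joint_law g (Suc t))"
      unfolding Suc.IH joint_law.simps measure_pmf_bind ..
    finally show ?case .
  qed
  \<comment> \<open>The pair at time \<open>t\<close> only reads the coordinates up to \<open>t\<close>, so it factors through the projection
      on which the limit measure agrees with the finite construction.\<close>
  have up_to: "IT.up_to {0..<Suc t} = Suc t"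
    using IT.up_to_less[of "{0..<Suc t}" t] by (intro antisym) (auto simp: IT.up_to_iff)
  have obs_restrict: "obs t (restrict x {0..<Suc t}) = obs t x" for x
    unfolding obs_def using history_cong[of t "restrict x {0..<Suc t}" x] by simp
  have restr: "(\<lambda>x. restrict x {0..<Suc t}) \<in> measurable IT.PF.lim (?P (Suc t))"
    by (auto intro!: measurable_restrict simp: measurable_cong_sets[OF IT.PF.sets_lim refl])
  have restr_C: "(\<lambda>x. restrict x {0..<Suc t}) \<in> measurable (IT.C 0 (Suc t) (\<lambda>_. undefined)) (?P (Suc t))"
    unfolding measurable_cong_sets[OF sets_C refl] by (auto intro!: measurable_restrict)
  have "distr (trajectory_measure n p g) (count_space UNIV) (obs t) =
      distr (distr IT.PF.lim (?P (Suc t)) (\<lambda>x. restrict x {0..<Suc t})) (count_space UNIV) (obs t)"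
    using restr by (subst distr_distr) (auto simp: comp_def obs_restrict trajectory_measure_def)
  also have "\<dots> = distr (IT.CI {0..<Suc t}) (count_space UNIV) (obs t)"
    by (subst IT.distr_lim) simp_all
  also have "\<dots> = distr (IT.C 0 (Suc t) (\<lambda>_. undefined)) (count_space UNIV) (obs t)"
    unfolding IT.CI_def up_to using restr_C
    by (subst distr_distr) (auto simp: comp_def obs_restrict simp del: IT.C.simps)
  finally show ?thesis
    unfolding fin by (simp add: obs_def[abs_def])
qed

end

section \<open>Filtering: the information state is sufficient\<close>

lemma info_state_next_history:
  assumes "length (fst h) = Suc (length (snd h))" and "u = case_prod g h"
  shows "case_prod info_state (next_history g h m) = info_step (u, observe u m) (case_prod info_state h)"
proof -
  obtain os us where h: "h = (os, us)" by (cases h)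
  then have "tl (os @ [x]) = tl os @ [x]" for x
    using assms(1) by (cases os) auto
  then show ?thesis
    using assms h by (simp add: next_history_def info_state_def Let_def)
qed

context fault_dynamics
begin

definition posterior :: "observation list \<times> action list \<Rightarrow> nat pmf" where
  "posterior h = case_prod belief (case_prod info_state h)"

text \<open>
  The law of the history alone. The next observation is drawn from the prediction made with the
  information state; \<open>joint_law_eq_posterior\<close> shows that this is the correct marginal law.
\<close>
primrec history_law :: "strategy \<Rightarrow> nat \<Rightarrow> (observation list \<times> action list) pmf" where
  "history_law g 0 = return_pmf ([Some 0], [])"
| "history_law g (Suc t) = history_law g t \<bind>
     (\<lambda>h. map_pmf (next_history g h) (posterior h \<bind> fault_kernel (case_prod g h)))"

text \<open>
  Properties that hold along all histories that can occur: the observations are one ahead of the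
  actions, so that \<open>info_state\<close> pairs every action with its effect, and the last fault count is in range.
\<close>
definition regular :: "observation list \<times> action list \<Rightarrow> bool" where
  "regular h \<longleftrightarrow> length (fst h) = Suc (length (snd h)) \<and> fst (case_prod info_state h) \<le> n"

lemma regular_next_history:
  assumes "regular h" and "m \<le> n"
  shows "regular (next_history g h m)"
proof -
  obtain s z where sz: "case_prod info_state h = (s, z)" by fastforce
  have "fst (case_prod info_state (next_history g h m)) \<le> n"
    using assms sz by (cases "case_prod g h")
      (simp_all add: regular_def info_state_next_history[OF _ refl])
  then show ?thesis
    using assms by (simp add: regular_def next_history_def Let_def)
qed

lemma set_pmf_posterior: "regular h \<Longrightarrow> set_pmf (posterior h) \<subseteq> {..n}"
  by (auto simp: regular_def posterior_def case_prod_beta dest: set_pmf_belief)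

lemma set_pmf_predicted:
  "regular h \<Longrightarrow> set_pmf (posterior h \<bind> fault_kernel u) \<subseteq> {..n}"
  using set_pmf_posterior set_pmf_fault_kernel by fastforce

lemma regular_history_law: "h \<in> set_pmf (history_law g t) \<Longrightarrow> regular h"
proof (induction t arbitrary: h)
  case 0
  then show ?case by (simp add: regular_def info_state_def)
next
  case (Suc t)
  then obtain h' m where h': "h' \<in> set_pmf (history_law g t)" "h = next_history g h' m"
    and m: "m \<in> set_pmf (posterior h' \<bind> fault_kernel (case_prod g h'))"
    by auto
  have "regular h'" by (rule Suc.IH[OF h'(1)])
  with m set_pmf_predicted have "m \<le> n" by blast
  then show ?case using \<open>regular h'\<close> h' by (simp add: regular_next_history)
qed

lemma finite_set_pmf_posterior: "regular h \<Longrightarrow> finite (set_pmf (posterior h))"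
  using set_pmf_posterior finite_subset by blast

lemma finite_set_pmf_predicted:
  "regular h \<Longrightarrow> finite (set_pmf (posterior h \<bind> fault_kernel u))"
  using set_pmf_predicted finite_subset by blast

lemma finite_set_pmf_history_law: "finite (set_pmf (history_law g t))"
proof (induction t)
  case (Suc t)
  have "finite (set_pmf (map_pmf (next_history g h) (posterior h \<bind> fault_kernel (case_prod g h))))"
    if "h \<in> set_pmf (history_law g t)" for h
    unfolding set_map_pmf
    by (intro finite_imageI finite_set_pmf_predicted regular_history_law[OF that])
  then show ?case
    unfolding history_law.simps set_bind_pmf using Suc.IH by blast
qed simp

text \<open>
  One step of the filter. A blank observation carries no information, so waiting only moves the
  belief one step forward; inspection reveals the new count; after a repair the count is known to be 0.
\<close>
lemma posterior_update:
  assumes "regular h"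
  shows "posterior h \<bind> (\<lambda>m. map_pmf (\<lambda>m'. (next_history g h m', m')) (fault_kernel (case_prod g h) m))
    = posterior h \<bind> fault_kernel (case_prod g h) \<bind>
        (\<lambda>m'. map_pmf (Pair (next_history g h m')) (posterior (next_history g h m')))"
    (is "?L = bind_pmf ?Q ?R")
proof -
  obtain s z where sz: "case_prod info_state h = (s, z)" by fastforce
  then have post: "posterior h = belief s z" by (simp add: posterior_def)
  have next_post: "posterior (next_history g h m') =
      case_prod belief (info_step (case_prod g h, observe (case_prod g h) m') (s, z))" for m'
    using assms sz by (simp add: posterior_def regular_def info_state_next_history[OF _ refl])
  have L: "?L = map_pmf (\<lambda>m'. (next_history g h m', m')) ?Q"
    by (simp add: map_bind_pmf)
  show ?thesis
  proof (cases "case_prod g h")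
    case Wait
    define H where "H = next_history g h 0"
    have H: "next_history g h = (\<lambda>_. H)"
      by (simp add: H_def fun_eq_iff next_history_def Wait)
    have Q: "?Q = belief s (Suc z)" by (simp add: Wait post fault_kernel_no_repair)
    have "posterior H = belief s (Suc z)"
      using next_post[of 0] by (simp add: H Wait)
    then show ?thesis unfolding L unfolding Q H by simp
  next
    case Inspect
    show ?thesis unfolding L next_post by (simp add: Inspect map_pmf_def bind_return_pmf)
  next
    case Repair
    show ?thesis unfolding L next_post by (simp add: Repair map_pmf_def bind_return_pmf)
  qed
qed

text \<open>
  Sufficiency of the information state. It holds under any strategy, because the action is a function
  of the history and so tells nothing more about the faults.
\<close>
lemma joint_law_eq_posterior:
  "joint_law g t = history_law g t \<bind> (\<lambda>h. map_pmf (Pair h) (posterior h))"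
proof (induction t)
  case 0
  show ?case by (simp add: posterior_def info_state_def bind_return_pmf)
next
  case (Suc t)
  let ?K = "\<lambda>h m. map_pmf (\<lambda>m'. (next_history g h m', m')) (fault_kernel (case_prod g h) m)"
  have "joint_law g (Suc t) = history_law g t \<bind> (\<lambda>h. posterior h \<bind> ?K h)"
    by (simp add: Suc.IH bind_assoc_pmf bind_map_pmf)
  also have "\<dots> = history_law g t \<bind> (\<lambda>h. posterior h \<bind> fault_kernel (case_prod g h) \<bind>
        (\<lambda>m'. map_pmf (Pair (next_history g h m')) (posterior (next_history g h m'))))"
    by (intro bind_pmf_cong refl posterior_update regular_history_law)
  also have "\<dots> = history_law g (Suc t) \<bind> (\<lambda>h. map_pmf (Pair h) (posterior h))"
    by (simp add: bind_assoc_pmf bind_map_pmf)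
  finally show ?case .
qed

text \<open>
  The true counterpart of the continuation value in \<open>action_value\<close>: here the elapsed time is not
  truncated.
\<close>
definition next_value :: "(nat \<Rightarrow> nat \<Rightarrow> real) \<Rightarrow> action \<Rightarrow> nat \<Rightarrow> nat \<Rightarrow> real" where
  "next_value F u s z = measure_pmf.expectation (belief s z \<bind> fault_kernel u)
     (\<lambda>m. case_prod F (info_step (u, observe u m) (s, z)))"

lemma next_value_simps [simp]:
  "next_value F Wait s z = F s (Suc z)"
  "next_value F Inspect s z = measure_pmf.expectation (belief s (Suc z)) (\<lambda>m. F m 0)"
  "next_value F Repair s z = F 0 0"
  by (simp_all add: next_value_def fault_kernel_no_repair)

lemma expectation_history_law_Suc:
  "measure_pmf.expectation (history_law g (Suc t)) (\<lambda>h. case_prod F (case_prod info_state h)) =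
   measure_pmf.expectation (history_law g t)
     (\<lambda>h. case_prod (next_value F (case_prod g h)) (case_prod info_state h))"
proof -
  have "measure_pmf.expectation (history_law g (Suc t)) (\<lambda>h. case_prod F (case_prod info_state h)) =
      measure_pmf.expectation (history_law g t) (\<lambda>h.
        measure_pmf.expectation (posterior h \<bind> fault_kernel (case_prod g h))
          (\<lambda>m. case_prod F (case_prod info_state (next_history g h m))))"
    unfolding history_law.simps
    by (subst expectation_bind_pmf_finite)
      (auto simp: finite_set_pmf_history_law simp del: set_bind_pmf
        intro!: finite_imageI finite_set_pmf_predicted intro: regular_history_law)
  also have "\<dots> = measure_pmf.expectation (history_law g t)
     (\<lambda>h. case_prod (next_value F (case_prod g h)) (case_prod info_state h))"
  proof (intro integral_cong_AE)
    show "AE h in history_law g t.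
        measure_pmf.expectation (posterior h \<bind> fault_kernel (case_prod g h))
          (\<lambda>m. case_prod F (case_prod info_state (next_history g h m)))
        = case_prod (next_value F (case_prod g h)) (case_prod info_state h)"
      unfolding AE_measure_pmf_iff
    proof
      fix h assume "h \<in> set_pmf (history_law g t)"
      then have h: "length (fst h) = Suc (length (snd h))"
        using regular_history_law regular_def by blast
      obtain s z where sz: "case_prod info_state h = (s, z)" by fastforce
      show "measure_pmf.expectation (posterior h \<bind> fault_kernel (case_prod g h))
          (\<lambda>m. case_prod F (case_prod info_state (next_history g h m)))
        = case_prod (next_value F (case_prod g h)) (case_prod info_state h)"
        by (simp only: posterior_def sz next_value_def prod.case info_state_next_history[OF h refl])
    qed
  qed simp_all
  finally show ?thesis .
qed

end

section \<open>The discounted cost and its lower bounds\<close>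

locale bounded_cost = fault_dynamics +
  fixes \<beta> C :: real and c :: "nat \<Rightarrow> action \<Rightarrow> real"
  assumes \<beta>_pos: "0 < \<beta>" and \<beta>_less_1: "\<beta> < 1"
    and cost_bound: "\<And>m u. m \<le> n \<Longrightarrow> \<bar>c m u\<bar> \<le> C"
begin

lemma abs_c_hat_le: "s \<le> n \<Longrightarrow> \<bar>c_hat n p c s z u\<bar> \<le> C"
  unfolding c_hat_eq_expectation by (rule abs_expectation_belief_le) (auto intro: cost_bound)

definition stage_cost :: "strategy \<Rightarrow> nat \<Rightarrow> real" where
  "stage_cost g t = measure_pmf.expectation (history_law g t)
     (\<lambda>h. case_prod (c_hat n p c) (case_prod info_state h) (case_prod g h))"

text \<open>
  The expectation may be taken term by term, since the terms are dominated by a geometric series, and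
  conditioning on the history replaces each cost by \<open>c_hat\<close> of the information state.
\<close>
lemma cost_sums_stage_cost: "(\<lambda>t. \<beta> ^ t * stage_cost g t) sums cost n p \<beta> c g"
proof -
  let ?M = "trajectory_measure n p g"
  interpret prob_space ?M by (rule prob_space_trajectory_measure)
  interpret IT: Ionescu_Tulcea "transition n p g" "\<lambda>_. count_space UNIV"
    by (rule Ionescu_Tulcea_transition)
  define obs where "obs t x = (history n g x t, faults n (x t))" for t x
  define c' where "c' = (\<lambda>(h, m). c m (case_prod g h))"
  have sets_M: "sets ?M = sets (PiM UNIV (\<lambda>_. count_space UNIV))"
    unfolding trajectory_measure_def by (rule IT.PF.sets_lim)
  have obs_meas: "obs t \<in> measurable ?M (count_space UNIV)" for t
    unfolding obs_def measurable_cong_sets[OF sets_M refl]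
    by (rule history_faults_measurable) simp
  have eq: "c (faults n (x t)) (action_at n g x t) = c' (obs t x)" for x t
    by (simp add: c'_def obs_def action_at_def)
  have le: "\<bar>c' (obs t x)\<bar> \<le> C" for t x
    using cost_bound faults_le by (simp add: c'_def obs_def)
  have meas: "(\<lambda>x. c' (obs t x)) \<in> borel_measurable ?M" for t
    by (rule measurable_compose[OF obs_meas]) simp
  have int: "integrable ?M (\<lambda>x. c' (obs t x))" for t
    by (rule integrable_const_bound[where B = C]) (use le meas in auto)
  have stage: "(\<integral>x. c' (obs t x) \<partial>?M) = stage_cost g t" for t
  proof -
    have "(\<integral>x. c' (obs t x) \<partial>?M) = measure_pmf.expectation (joint_law g t) c'"
      unfolding distr_trajectory_measure[symmetric]
      using obs_meas by (subst integral_distr) (auto simp: obs_def[abs_def])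
    also have "\<dots> = measure_pmf.expectation (history_law g t)
        (\<lambda>h. measure_pmf.expectation (posterior h) (\<lambda>m. c m (case_prod g h)))"
      unfolding joint_law_eq_posterior
      by (subst expectation_bind_pmf_finite)
        (auto simp: c'_def finite_set_pmf_history_law
          intro: finite_set_pmf_posterior regular_history_law)
    also have "\<dots> = stage_cost g t"
      unfolding stage_cost_def
      by (intro integral_cong_AE)
        (auto simp: AE_measure_pmf_iff posterior_def regular_def case_prod_beta
          c_hat_eq_expectation dest!: regular_history_law)
    finally show ?thesis .
  qed
  have geo: "summable (\<lambda>t. \<beta> ^ t * C)"
    using \<beta>_pos \<beta>_less_1 by (intro summable_mult2 summable_geometric) simp
  have norm_le: "norm (\<beta> ^ t * c' (obs t x)) \<le> \<beta> ^ t * C" for t x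
    using le[of t x] \<beta>_pos by (simp add: abs_mult mult_left_mono)
  have "(\<lambda>t. \<integral>x. \<beta> ^ t * c' (obs t x) \<partial>?M) sums (\<integral>x. (\<Sum>t. \<beta> ^ t * c' (obs t x)) \<partial>?M)"
  proof (rule sums_integral)
    show "integrable ?M (\<lambda>x. \<beta> ^ t * c' (obs t x))" for t
      using int by simp
    show "AE x in ?M. summable (\<lambda>t. norm (\<beta> ^ t * c' (obs t x)))"
      using norm_le by (intro AE_I2 summable_comparison_test'[OF geo, of 0]) simp
    have "(\<integral>x. norm (\<beta> ^ t * c' (obs t x)) \<partial>?M) \<le> \<beta> ^ t * C" for t
      using int norm_le by (intro integral_le_const) auto
    then show "summable (\<lambda>t. \<integral>x. norm (\<beta> ^ t * c' (obs t x)) \<partial>?M)"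
      by (intro summable_comparison_test'[OF geo, of 0]) simp
  qed
  then show ?thesis
    by (simp add: stage cost_def eq)
qed

lemma cost_uminus: "cost n p \<beta> (\<lambda>m u. - c m u) g = - cost n p \<beta> c g"
proof -
  have "summable (\<lambda>t. \<beta> ^ t * c (faults n (x t)) (action_at n g x t))" for x
  proof (rule summable_comparison_test'[of "\<lambda>t. \<beta> ^ t * C" 0])
    show "summable (\<lambda>t. \<beta> ^ t * C)"
      using \<beta>_pos \<beta>_less_1 by (intro summable_mult2 summable_geometric) simp
    show "norm (\<beta> ^ t * c (faults n (x t)) (action_at n g x t)) \<le> \<beta> ^ t * C" for t
      using cost_bound[OF faults_le] \<beta>_pos by (simp add: abs_mult mult_left_mono)
  qed
  then show ?thesis
    by (simp add: cost_def suminf_minus)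
qed

text \<open>
  Verification principle: iterating the one-step inequality sums up the stage costs, and the
  remainder disappears by discounting because \<open>F\<close> is bounded above. The inequality is only asked at
  the actions of \<open>g\<close>, so that the lemma serves both for arbitrary strategies and, with the signs reversed, for
  a fixed one.
\<close>
lemma cost_ge_of_subsolution:
  assumes F_le: "\<And>s z. s \<le> n \<Longrightarrow> F s z \<le> B"
    and step: "\<And>os us s z. info_state os us = (s, z) \<Longrightarrow> s \<le> n \<Longrightarrow>
      F s z \<le> c_hat n p c s z (g os us) + \<beta> * next_value F (g os us) s z"
  shows "F 0 0 \<le> cost n p \<beta> c g"
proof -
  define E where "E t = measure_pmf.expectation (history_law g t)
    (\<lambda>h. case_prod F (case_prod info_state h))" for t
  have E_le: "E t \<le> B" for t
    unfolding E_def
    by (intro measure_pmf.integral_le_const integrable_measure_pmf_finite finite_set_pmf_history_law)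
      (auto simp: AE_measure_pmf_iff regular_def case_prod_beta intro!: F_le dest!: regular_history_law)
  have E_step: "E t \<le> stage_cost g t + \<beta> * E (Suc t)" for t
  proof -
    let ?q = "history_law g t"
    note int = integrable_measure_pmf_finite[OF finite_set_pmf_history_law]
    have "E t \<le> measure_pmf.expectation ?q (\<lambda>h.
        case_prod (c_hat n p c) (case_prod info_state h) (case_prod g h) +
        \<beta> * case_prod (next_value F (case_prod g h)) (case_prod info_state h))"
      unfolding E_def
    proof (rule expectation_pmf_mono[OF finite_set_pmf_history_law])
      fix h assume "h \<in> set_pmf ?q"
      then have reg: "regular h" by (rule regular_history_law)
      obtain os us s z where h: "h = (os, us)" and sz: "info_state os us = (s, z)"
        by (cases h) fastforce
      show "case_prod F (case_prod info_state h) \<le>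
          case_prod (c_hat n p c) (case_prod info_state h) (case_prod g h) +
          \<beta> * case_prod (next_value F (case_prod g h)) (case_prod info_state h)"
        using step[OF sz] reg by (simp add: h sz regular_def)
    qed
    also have "\<dots> = stage_cost g t + \<beta> * E (Suc t)"
      unfolding E_def expectation_history_law_Suc stage_cost_def
      by (subst Bochner_Integration.integral_add) (auto intro!: int)
    finally show ?thesis .
  qed
  \<comment> \<open>The remainder after \<open>N\<close> steps is kept exact here and bounded only afterwards.\<close>
  have "F 0 0 \<le> (\<Sum>t<N. \<beta> ^ t * stage_cost g t) + \<beta> ^ N * E N" for N
  proof (induction N)
    case 0
    show ?case by (simp add: E_def info_state_def)
  next
    case (Suc N)
    have "\<beta> ^ N * E N \<le> \<beta> ^ N * (stage_cost g N + \<beta> * E (Suc N))"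
      using E_step \<beta>_pos by (intro mult_left_mono) auto
    with Suc show ?case by (simp add: algebra_simps)
  qed
  moreover have "\<beta> ^ N * E N \<le> \<beta> ^ N * B" for N
    using E_le \<beta>_pos by (intro mult_left_mono) auto
  ultimately have le: "F 0 0 \<le> (\<Sum>t<N. \<beta> ^ t * stage_cost g t) + \<beta> ^ N * B" for N
    by (meson add_left_mono order_trans)
  have "(\<lambda>N. (\<Sum>t<N. \<beta> ^ t * stage_cost g t) + \<beta> ^ N * B) \<longlonglongrightarrow> cost n p \<beta> c g + 0 * B"
    using cost_sums_stage_cost[of g] \<beta>_pos \<beta>_less_1
    by (intro tendsto_add tendsto_mult tendsto_const LIMSEQ_realpow_zero) (auto simp: sums_def)
  then show ?thesis
    using le by (intro LIMSEQ_le_const[of _ "cost n p \<beta> c g"]) auto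
qed

section \<open>The truncated Bellman equation\<close>

lemma truncated_value_bound:
  assumes fixpoint: "\<And>s z. s \<le> n \<Longrightarrow> z \<le> k \<Longrightarrow> V s z = action_value n p \<beta> c k V (\<gamma> s z) s z"
    and sz: "s \<le> n" "z \<le> k"
  shows "\<bar>V s z\<bar> \<le> C / (1 - \<beta>)"
proof -
  let ?S = "(\<lambda>(s, z). \<bar>V s z\<bar>) ` ({..n} \<times> {..k})"
  \<comment> \<open>The largest absolute value \<open>B\<close> is attained, and the equation there gives \<open>B \<le> C + \<beta> * B\<close>.\<close>
  define B where "B = Max ?S"
  have fin: "finite ?S" by simp
  have le: "\<bar>V s z\<bar> \<le> B" if "s \<le> n" "z \<le> k" for s z
    unfolding B_def using that by (intro Max_ge[OF fin]) auto
  have "B \<in> ?S"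
    unfolding B_def by (intro Max_in[OF fin]) auto
  then obtain s' z' where s'z': "s' \<le> n" "z' \<le> k" and B: "B = \<bar>V s' z'\<bar>" by auto
  have "\<bar>action_value n p \<beta> c k V u s' z'\<bar> \<le> C + \<beta> * B" for u
  proof -
    obtain w where w: "action_value n p \<beta> c k V u s' z' = c_hat n p c s' z' u + \<beta> * w"
      and wB: "\<bar>w\<bar> \<le> B"
    proof (cases u)
      case Wait
      show ?thesis
        by (rule that[of "if z' < k then V s' (1 + z') else V 0 0"])
          (use s'z' le Wait in auto)
    next
      case Inspect
      have "\<bar>measure_pmf.expectation (belief s' (Suc z')) (\<lambda>m. V m 0)\<bar> \<le> B"
        by (rule abs_expectation_belief_le) (use s'z' le in auto)
      with s'z' show ?thesis
        unfolding Inspect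
        by (intro that[of "measure_pmf.expectation (belief s' (Suc z')) (\<lambda>m. V m 0)"])
          (simp_all only: Inspect action_value_Inspect)
    next
      case Repair
      show ?thesis by (rule that[of "V 0 0"]) (use le Repair in auto)
    qed
    have "\<bar>\<beta> * w\<bar> \<le> \<beta> * B"
      using wB \<beta>_pos by (simp add: abs_mult mult_left_mono)
    then show ?thesis
      unfolding w using abs_c_hat_le[OF s'z'(1), of z' u] by linarith
  qed
  then have "B \<le> C + \<beta> * B"
    using fixpoint[OF s'z'] B by metis
  then have "B \<le> C / (1 - \<beta>)"
    using \<beta>_less_1 by (simp add: field_simps)
  with le[OF sz] show ?thesis by simp
qed

text \<open>
  The truncated and the true model differ only when the strategy waits at elapsed time \<open>k\<close>; this cannot
  happen earlier than at the \<open>(k + 1)\<close>-st step, and from then on the true cost is at least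
  \<open>- C / (1 - \<beta>)\<close>. To avoid reasoning about this random time, the loss is
  built into a subsolution \<open>F\<close> of the true model: the truncated value, minus the
  loss discounted by the least number of steps to the exit, but never below the bound \<open>- C / (1 - \<beta>)\<close>.
  Beyond elapsed time \<open>k\<close>, where \<open>F\<close> is this bound, the cut-off is what keeps \<open>F\<close> a subsolution: a later
  inspection or repair must not lead to a smaller value.
\<close>
lemma cost_ge_truncated_value:
  assumes V_le: "\<And>os us s z. info_state os us = (s, z) \<Longrightarrow> s \<le> n \<Longrightarrow> z \<le> k \<Longrightarrow>
      V s z \<le> action_value n p \<beta> c k V (g os us) s z"
    and V_ge: "- (C / (1 - \<beta>)) \<le> V 0 0"
  shows "V 0 0 - \<beta> ^ (k + 1) * (V 0 0 + C / (1 - \<beta>)) \<le> cost n p \<beta> c g"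
proof -
  define M where "M = C / (1 - \<beta>)"
  \<comment> \<open>\<open>D\<close> is the most that is gained by leaving the truncated model and receiving the lowest
      possible cost \<open>- M\<close> instead of \<open>V 0 0\<close>. Leaving from elapsed time \<open>z\<close> takes at least
      \<open>k + 1 - z\<close> further steps, which explains the exponent in \<open>F\<close>.\<close>
  define D where "D = V 0 0 + M"
  define F where "F s z = (if z \<le> k then max (- M) (V s z - \<beta> ^ (k + 1 - z) * D) else - M)" for s z
  have D: "D \<ge> 0" using V_ge by (simp add: D_def M_def)
  have M: "C = (1 - \<beta>) * M" using \<beta>_less_1 by (simp add: M_def)
  have F_ge: "F s z \<ge> - M" for s z by (simp add: F_def)
  have F_ge': "z \<le> k \<Longrightarrow> F s z \<ge> V s z - \<beta> ^ (k + 1 - z) * D" for s z by (simp add: F_def)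
  have "F s z \<le> max (- M) (Max ((\<lambda>(s, z). V s z) ` ({..n} \<times> {..k})))" if "s \<le> n" for s z
  proof (cases "z \<le> k")
    case True
    have "V s z \<le> Max ((\<lambda>(s, z). V s z) ` ({..n} \<times> {..k}))"
      using that True by (intro Max_ge) auto
    moreover have "0 \<le> \<beta> ^ (k + 1 - z) * D" using D \<beta>_pos by simp
    ultimately show ?thesis using True by (simp add: F_def)
  qed (simp add: F_def)
  moreover have "F s z \<le> c_hat n p c s z (g os us) + \<beta> * next_value F (g os us) s z"
    if info: "info_state os us = (s, z)" and s: "s \<le> n" for os us s z
  proof -
    let ?u = "g os us"
    have fin: "finite (set_pmf (belief s z'))" for z' using finite_set_pmf_belief[OF s] .
    \<comment> \<open>The constant \<open>- M\<close> is itself a subsolution, because \<open>C + \<beta> * M = M\<close>.\<close>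
    have "- M \<le> next_value F ?u s z"
    proof (cases ?u)
      case Inspect
      have "- M \<le> measure_pmf.expectation (belief s (Suc z)) (\<lambda>m. F m 0)"
        using F_ge
        by (intro measure_pmf.integral_ge_const integrable_measure_pmf_finite fin AE_I2)
      then show ?thesis by (simp only: Inspect next_value_simps)
    qed (simp_all add: F_ge)
    then have "\<beta> * (- M) \<le> \<beta> * next_value F ?u s z"
      using \<beta>_pos by (intro mult_left_mono) auto
    moreover have "- C \<le> c_hat n p c s z ?u"
      using abs_c_hat_le[OF s, of z ?u] by linarith
    ultimately have lower: "- M \<le> c_hat n p c s z ?u + \<beta> * next_value F ?u s z"
      by (simp add: M algebra_simps)
    moreover have "V s z - \<beta> ^ (k + 1 - z) * D \<le> c_hat n p c s z ?u + \<beta> * next_value F ?u s z"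
      if z: "z \<le> k"
    proof -
      \<comment> \<open>Inspection and repair reset the elapsed time, so they only make the exit more remote.\<close>
      have pow: "\<beta> ^ (k + 1) * D \<le> \<beta> ^ (k - z) * D"
        using D \<beta>_pos \<beta>_less_1 by (intro mult_right_mono power_decreasing) auto
      have "action_value n p \<beta> c k V ?u s z \<le>
          c_hat n p c s z ?u + \<beta> * (next_value F ?u s z + \<beta> ^ (k - z) * D)"
      proof (cases ?u)
        case Wait
        show ?thesis
        proof (cases "z = k")
          case True
          \<comment> \<open>Here the truncated model jumps to \<open>(0, 0)\<close>; the true next value is \<open>F s (Suc k) = - M\<close>.\<close>
          then show ?thesis by (simp add: Wait F_def D_def)
        next
          case False
          then have "V s (Suc z) - \<beta> ^ (k - z) * D \<le> F s (Suc z)"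
            using F_ge'[of "Suc z" s] z by simp
          then show ?thesis using False z \<beta>_pos by (simp add: Wait)
        qed
      next
        case Inspect
        let ?E = "measure_pmf.expectation (belief s (Suc z))"
        have "?E (\<lambda>m. V m 0) \<le> ?E (\<lambda>m. F m 0 + \<beta> ^ (k + 1) * D)"
          using F_ge'[of 0] by (intro expectation_pmf_mono fin) (simp add: algebra_simps)
        also have "\<dots> = ?E (\<lambda>m. F m 0) + \<beta> ^ (k + 1) * D"
          by (subst Bochner_Integration.integral_add)
            (auto intro!: integrable_measure_pmf_finite fin simp del: belief.simps)
        finally have le: "?E (\<lambda>m. V m 0) \<le> ?E (\<lambda>m. F m 0) + \<beta> ^ (k - z) * D"
          using pow by linarith
        have "action_value n p \<beta> c k V ?u s z = c_hat n p c s z ?u + \<beta> * ?E (\<lambda>m. V m 0)"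
          by (simp only: Inspect action_value_Inspect[OF s])
        then show ?thesis
          using mult_left_mono[OF le, of \<beta>] \<beta>_pos by (simp add: Inspect del: belief.simps)
      next
        case Repair
        have "V 0 0 \<le> F 0 0 + \<beta> ^ (k - z) * D"
          using F_ge'[of 0 0] pow by simp
        then show ?thesis using \<beta>_pos by (simp add: Repair)
      qed
      moreover have "\<beta> ^ (k + 1 - z) = \<beta> * \<beta> ^ (k - z)"
        using z by (simp add: Suc_diff_le)
      ultimately show ?thesis
        using V_le[OF info s z] by (simp add: algebra_simps)
    qed
    ultimately show ?thesis by (simp add: F_def)
  qed
  ultimately have "F 0 0 \<le> cost n p \<beta> c g"
    by (rule cost_ge_of_subsolution)
  with F_ge'[of 0 0] show ?thesis by (simp add: D_def M_def)
qed

text \<open>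
  Changing the sign of costs and values turns upper bounds into lower bounds.
\<close>
lemma cost_le_truncated_value:
  assumes V_ge: "\<And>os us s z. info_state os us = (s, z) \<Longrightarrow> s \<le> n \<Longrightarrow> z \<le> k \<Longrightarrow>
      action_value n p \<beta> c k V (g os us) s z \<le> V s z"
    and V_le: "V 0 0 \<le> C / (1 - \<beta>)"
  shows "cost n p \<beta> c g \<le> V 0 0 + \<beta> ^ (k + 1) * (C / (1 - \<beta>) - V 0 0)"
proof -
  interpret neg: bounded_cost n p \<beta> C "\<lambda>m u. - c m u"
    using \<beta>_pos \<beta>_less_1 cost_bound by unfold_locales auto
  have "action_value n p \<beta> (\<lambda>m u. - c m u) k (\<lambda>s z. - V s z) u s z =
      - action_value n p \<beta> c k V u s z" for u s z
    by (cases u) (simp_all add: c_hat_def sum_negf algebra_simps)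
  then have "- V 0 0 - \<beta> ^ (k + 1) * (- V 0 0 + C / (1 - \<beta>)) \<le> cost n p \<beta> (\<lambda>m u. - c m u) g"
    using V_ge V_le by (intro neg.cost_ge_truncated_value) auto
  then show ?thesis
    unfolding cost_uminus by (simp add: algebra_simps)
qed

end

section \<open>Near-optimality of the truncated solution\<close>

theorem theorem3:
  fixes n k :: nat and p \<beta> \<epsilon> c_max :: real
    and c :: "nat \<Rightarrow> action \<Rightarrow> real"
    and V :: "nat \<Rightarrow> nat \<Rightarrow> real"
    and \<gamma> :: "nat \<Rightarrow> nat \<Rightarrow> action"
  assumes "n \<ge> 1" and "0 \<le> p" and "p \<le> 1" and "0 < \<beta>" and "\<beta> < 1"
    and "c_max > 0" and "\<And>m u. m \<le> n \<Longrightarrow> \<bar>c m u\<bar> \<le> c_max"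
    and "\<epsilon> > 0"
    and "k \<ge> 1" and "real k \<ge> ln ((1 - \<beta>) * \<epsilon> / (2 * c_max)) / ln \<beta>"
    and "solves_bellman n p \<beta> c k V"
    and "\<And>s z. s \<le> n \<Longrightarrow> z \<le> k \<Longrightarrow> action_value n p \<beta> c k V (\<gamma> s z) s z = V s z"
  shows "\<bar>optimal_cost n p \<beta> c - cost n p \<beta> c (info_strategy \<gamma>)\<bar> \<le> \<epsilon>"
proof -
  interpret bounded_cost n p \<beta> c_max c
    using assms by unfold_locales auto
  define M where "M = c_max / (1 - \<beta>)"
  have abs_V: "\<bar>V 0 0\<bar> \<le> M"
    unfolding M_def by (rule truncated_value_bound[of k V \<gamma>]) (use assms in auto)
  have V_le: "V s z \<le> action_value n p \<beta> c k V u s z" if "s \<le> n" "z \<le> k" for s z u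
  proof -
    have "V s z = (MIN u\<in>{Wait, Inspect, Repair}. action_value n p \<beta> c k V u s z)"
      using \<open>solves_bellman n p \<beta> c k V\<close> that by (simp only: solves_bellman_def)
    also have "\<dots> \<le> action_value n p \<beta> c k V u s z"
      by (cases u) (auto intro!: Min_le)
    finally show ?thesis .
  qed
  define L where "L = V 0 0 - \<beta> ^ (k + 1) * (V 0 0 + M)"
  have lower: "L \<le> cost n p \<beta> c g" for g
    unfolding L_def M_def
    by (rule cost_ge_truncated_value) (use V_le abs_V in \<open>auto simp: M_def\<close>)
  have upper: "cost n p \<beta> c (info_strategy \<gamma>) \<le> V 0 0 + \<beta> ^ (k + 1) * (M - V 0 0)"
    unfolding M_def
    by (rule cost_le_truncated_value) (use assms abs_V in \<open>auto simp: M_def info_strategy_def\<close>)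
  have "L \<le> optimal_cost n p \<beta> c"
    unfolding optimal_cost_def using lower by (intro cINF_greatest) auto
  moreover have "optimal_cost n p \<beta> c \<le> cost n p \<beta> c (info_strategy \<gamma>)"
    unfolding optimal_cost_def
    by (rule cINF_lower) (use lower in \<open>auto intro!: bdd_belowI2\<close>)
  ultimately have "\<bar>optimal_cost n p \<beta> c - cost n p \<beta> c (info_strategy \<gamma>)\<bar> \<le>
      (V 0 0 + \<beta> ^ (k + 1) * (M - V 0 0)) - L"
    using upper by linarith
  \<comment> \<open>The unknown value \<open>V 0 0\<close> cancels between the two one-sided bounds.\<close>
  also have "\<dots> = \<beta> ^ (k + 1) * (2 * M)"
    by (simp add: L_def algebra_simps)
  also have "\<dots> \<le> \<beta> ^ k * (2 * M)"
    using \<beta>_pos \<beta>_less_1 abs_V by (intro mult_right_mono power_decreasing) auto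
  also have "\<dots> \<le> (1 - \<beta>) * \<epsilon> / (2 * c_max) * (2 * M)"
  proof (rule mult_right_mono)
    have "ln \<beta> < 0" using \<beta>_pos \<beta>_less_1 by simp
    then have "real k * ln \<beta> \<le> ln ((1 - \<beta>) * \<epsilon> / (2 * c_max))"
      using assms(10) by (simp add: neg_divide_le_eq)
    then have "ln (\<beta> ^ k) \<le> ln ((1 - \<beta>) * \<epsilon> / (2 * c_max))"
      using \<beta>_pos by (simp add: ln_realpow)
    then show "\<beta> ^ k \<le> (1 - \<beta>) * \<epsilon> / (2 * c_max)"
      using assms by (subst (asm) ln_le_cancel_iff) auto
    show "0 \<le> 2 * M" using abs_V by simp
  qed
  also have "\<dots> = \<epsilon>"
    using assms by (simp add: M_def)
  finally show ?thesis .
qed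

end
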